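(* Let $\mathcal{H}$ be a Hilbert space of dimension at least two, let $R>0$, let $A\subset\mathcal{H}$ be an $R$-proximally smooth set, and let $a,b\in A$ be two distinct points with $|a-b|<2R$. Then there exists a curve $\gamma$ in $A$ connecting $a$ and $b$ whose length is at most $2R\arcsin\frac{|a-b|}{2R}$.
   Context: $|\cdot|$ is the norm of $\mathcal{H}$; $\operatorname{dist}(x,A)=\inf_{y\in A}|x-y|$. A set $A$ is $R$-proximally smooth if it is closed and $x\mapsto \operatorname{dist}(x,A)$ is continuously differentiable on $\{x: 0<\operatorname{dist}(x,A)<R\}$. A curve is a continuous map from a non-degenerate segment of $\mathbb{R}$; its length is its total variation. *)

theory Defs
  imports "HOL-Analysis.Analysis"
begin

text \<open>Continuous differentiability in the Frechet sense: the derivative is continuous with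
  respect to the operator norm. Meant for open \<open>U\<close>.\<close>

definition continuously_differentiable_on ::
    "('a::real_normed_vector \<Rightarrow> 'b::real_normed_vector) \<Rightarrow> 'a set \<Rightarrow> bool" where
  "continuously_differentiable_on f U \<longleftrightarrow>
     (\<exists>D :: 'a \<Rightarrow> 'a \<Rightarrow>\<^sub>L 'b.
        (\<forall>x\<in>U. (f has_derivative blinfun_apply (D x)) (at x)) \<and> continuous_on U D)"

text \<open>The library sets \<open>infdist x {} = 0\<close>. The empty set is proximally smooth under this
  convention, as it is under \<open>dist(x, {}) = \<infinity>\<close>.\<close>

definition proximally_smooth :: "real \<Rightarrow> 'a::real_normed_vector set \<Rightarrow> bool" where
  "proximally_smooth R A \<longleftrightarrow>
     closed A \<and>
     continuously_differentiable_on (\<lambda>x. infdist x A) {x. 0 < infdist x A \<and> infdist x A < R}"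

definition partitions :: "real \<Rightarrow> real \<Rightarrow> (nat \<times> (nat \<Rightarrow> real)) set" where
  "partitions s t = {(n, p). p 0 = s \<and> p n = t \<and> (\<forall>i<n. p i < p (Suc i))}"

text \<open>Meant for \<open>s \<le> t\<close>; the value may be \<open>\<infinity>\<close>.\<close>

definition total_variation :: "real \<Rightarrow> real \<Rightarrow> (real \<Rightarrow> 'a::metric_space) \<Rightarrow> ereal" where
  "total_variation s t f =
     (SUP (n, p) \<in> partitions s t. ereal (\<Sum>i<n. dist (f (p i)) (f (p (Suc i)))))"

end

theory Submission
  imports Defs
begin

text \<open>Off \<open>A\<close>, wherever the distance function \<open>d\<close> of \<open>A\<close> is Frechet differentiable, its slope
  is 1. By Ekeland's principle this infinitesimal growth integrates inside the tube
  \<open>0 < d < R\<close>: the ball around \<open>x\<close> of radius \<open>R - d x\<close> contains points where \<open>d\<close> is as close to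
  \<open>R\<close> as desired. Let \<open>m\<close> be the midpoint of \<open>a, b \<in> A\<close> and \<open>z\<close> such a point near \<open>m\<close>.
  Then \<open>a\<close> and \<open>b\<close> have distance at least \<open>d z\<close> from \<open>z\<close>, and the parallelogram law gives
  \<open>d m \<le> R - sqrt (R\<^sup>2 - |a - b|\<^sup>2 / 4)\<close>, the height of the arc of radius \<open>R\<close> over the chord \<open>[a, b]\<close>.
  The nearest point \<open>c\<close> of \<open>m\<close> in \<open>A\<close> exists by uniform convexity, and the angles
  \<open>\<alpha>, \<beta>, \<theta>\<close> subtended by the chords \<open>[a, c], [c, b], [a, b]\<close> in a circle of radius \<open>R\<close> satisfy
  \<open>\<alpha> + \<beta> \<le> \<theta>\<close>. Inserting such points \<open>c\<close> repeatedly yields the curve on the dyadic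
  rationals.\<close>

section \<open>Curves from iterated midpoints\<close>

text \<open>Level \<open>n\<close> lists the endpoints of \<open>2 ^ n\<close> segments at the
  indices from 0 to \<open>2 ^ n\<close>. Giving every nonzero index at level 0 the value
  \<open>b\<close> makes the recursion total, so invariants need no bound on
  \<open>k\<close>.\<close>

fun bisect :: "('a \<Rightarrow> 'a \<Rightarrow> 'a) \<Rightarrow> 'a \<Rightarrow> 'a \<Rightarrow> nat \<Rightarrow> nat \<Rightarrow> 'a" where
  "bisect c a b 0 k = (if k = 0 then a else b)"
| "bisect c a b (Suc n) k =
    (if even k then bisect c a b n (k div 2)
     else c (bisect c a b n (k div 2)) (bisect c a b n (Suc (k div 2))))"

lemma bisect_0 [simp]: "bisect c a b n 0 = a"
  by (induction n) auto

lemma bisect_two_power [simp]: "bisect c a b n (2 ^ n) = b"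
  by (induction n) auto

text \<open>\<open>P b b\<close> covers the neighbours beyond the last index, which at level 0 both
  equal \<open>b\<close>.\<close>

lemma bisect_in:
  assumes "\<And>x y. x \<in> A \<Longrightarrow> y \<in> A \<Longrightarrow> P x y \<Longrightarrow> c x y \<in> A \<and> P x (c x y) \<and> P (c x y) y"
    and "a \<in> A" "b \<in> A" "P a b" "P b b"
  shows "bisect c a b n k \<in> A \<and> P (bisect c a b n k) (bisect c a b n (Suc k))"
proof (induction n arbitrary: k)
  case 0
  then show ?case using assms by auto
next
  case (Suc n)
  have "c (bisect c a b n j) (bisect c a b n (Suc j)) \<in> A \<and>
      P (bisect c a b n j) (c (bisect c a b n j) (bisect c a b n (Suc j))) \<and>
      P (c (bisect c a b n j) (bisect c a b n (Suc j))) (bisect c a b n (Suc j))" for j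
    using assms(1) Suc by blast
  then show ?case using Suc by auto
qed

lemma sum_double:
  fixes f :: "nat \<Rightarrow> 'b::comm_monoid_add"
  shows "(\<Sum>j<2 * k. f j) = (\<Sum>j<k. f (2 * j) + f (Suc (2 * j)))"
  by (induction k) (auto simp: add.assoc)

text \<open>The factor \<open>q\<close> makes gaps decay geometrically, so the step functions
  through the points of each level converge uniformly, and their jumps vanish in the limit.
  Splitting never raises the total \<open>len\<close>, which dominates distances; this bounds every
  partition sum of the limit.\<close>

lemma curve_from_midpoints:
  fixes A :: "'a::complete_space set" and len :: "'a \<Rightarrow> 'a \<Rightarrow> real"
  assumes A: "closed A" "a \<in> A" "b \<in> A"
    and q: "0 \<le> q" "q < 1"
    and len: "\<And>x y. x \<in> A \<Longrightarrow> y \<in> A \<Longrightarrow> dist x y \<le> dist a b \<Longrightarrow> dist x y \<le> len x y"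
    and mid: "\<And>x y. x \<in> A \<Longrightarrow> y \<in> A \<Longrightarrow> dist x y \<le> dist a b \<Longrightarrow>
      \<exists>c\<in>A. dist x c \<le> q * dist x y \<and> dist c y \<le> q * dist x y \<and> len x c + len c y \<le> len x y"
  shows "\<exists>\<gamma>. continuous_on {0..1} \<gamma> \<and> \<gamma> ` {0..1} \<subseteq> A \<and> \<gamma> 0 = a \<and> \<gamma> 1 = b \<and>
    total_variation 0 1 \<gamma> \<le> ereal (len a b)"
proof -
  obtain c where c: "\<And>x y. x \<in> A \<Longrightarrow> y \<in> A \<Longrightarrow> dist x y \<le> dist a b \<Longrightarrow>
      c x y \<in> A \<and> dist x (c x y) \<le> q * dist x y \<and> dist (c x y) y \<le> q * dist x y \<and>
      len x (c x y) + len (c x y) y \<le> len x y"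
    using mid by metis
  define P where "P = bisect c a b"
  define s where "s = dist a b"
  have s0: "s \<ge> 0" by (simp add: s_def)
  have qle: "q * t \<le> u" if "0 \<le> t" "t \<le> u" for t u
    using that q by (meson mult_left_le_one_le less_imp_le order_trans)
  have "c x y \<in> A \<and> dist x (c x y) \<le> s \<and> dist (c x y) y \<le> s"
    if "x \<in> A" "y \<in> A" "dist x y \<le> s" for x y
    using c[of x y] qle[OF zero_le_dist that(3)] that by (auto simp: s_def)
  then have "P n k \<in> A \<and> dist (P n k) (P n (Suc k)) \<le> s" for n k
    unfolding P_def
    by (rule bisect_in[where P = "\<lambda>x y. dist x y \<le> s"]) (use A s0 in \<open>auto simp: s_def\<close>)
  then have PA: "P n k \<in> A" and Ps: "dist (P n k) (P n (Suc k)) \<le> dist a b" for n k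
    by (auto simp: s_def)
  have P_even: "P (Suc n) (2 * k) = P n k" for n k
    by (simp add: P_def)
  have P_odd: "P (Suc n) (Suc (2 * k)) = c (P n k) (P n (Suc k))" for n k
    by (simp add: P_def)
  have P_even': "P (Suc n) (Suc (Suc (2 * k))) = P n (Suc k)" for n k
    by (simp add: P_def)
  have Pq: "dist (P n k) (P n (Suc k)) \<le> q ^ n * s" for n k
  proof (induction n arbitrary: k)
    case 0
    then show ?case by (auto simp: P_def s_def)
  next
    case (Suc n)
    define j where "j = k div 2"
    have "q * dist (P n j) (P n (Suc j)) \<le> q * (q ^ n * s)"
      using Suc q by (intro mult_left_mono) auto
    moreover have "dist (P (Suc n) k) (P (Suc n) (Suc k)) \<le> q * dist (P n j) (P n (Suc j))"
    proof (cases "even k")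
      case True
      then have "k = 2 * j" by (simp add: j_def)
      then show ?thesis using c[OF PA PA Ps] P_even P_odd by simp
    next
      case False
      then have "k = Suc (2 * j)" by (simp add: j_def)
      then show ?thesis using c[OF PA PA Ps] P_even' P_odd by simp
    qed
    ultimately show ?case by simp
  qed
  \<comment> \<open>Sums of distances may grow under refinement, but sums of \<open>len\<close> do
    not. Differences of \<open>B n\<close> bound distances at level \<open>n\<close> and telescope
    along a partition.\<close>
  define B where "B n k = (\<Sum>j<k. len (P n j) (P n (Suc j)))" for n k
  have "B (Suc n) (2 * k) \<le> B n k" for n k
    unfolding B_def sum_double
    by (rule sum_mono) (use c[OF PA PA Ps] P_even P_odd P_even' in simp)
  moreover have "B 0 1 = len a b" by (simp add: B_def P_def)
  ultimately have B_total: "B n (2 ^ n) \<le> len a b" for n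
    by (induction n) (simp_all, metis order_trans)
  have B_diff: "dist (P n k) (P n l) \<le> B n l - B n k" if "k \<le> l" for n k l
    using that
  proof (induction l rule: dec_induct)
    case base
    then show ?case by simp
  next
    case (step l)
    have "dist (P n k) (P n (Suc l)) \<le> dist (P n k) (P n l) + dist (P n l) (P n (Suc l))"
      by (rule dist_triangle)
    also have "\<dots> \<le> (B n l - B n k) + len (P n l) (P n (Suc l))"
      using step.IH len[OF PA PA Ps] by (rule add_mono)
    finally show ?case by (simp add: B_def)
  qed
  \<comment> \<open>Index of the dyadic interval of length \<open>1 / 2 ^ n\<close> that contains
    \<open>t\<close>; thus \<open>f n\<close> is the step function taking the value at the left
    endpoint.\<close>
  define K where "K n t = nat \<lfloor>t * 2 ^ n\<rfloor>" for n and t :: real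
  define f where "f n t = P n (K n t)" for n t
  have K_mono: "K n t \<le> K n u" if "t \<le> u" for n t u
    unfolding K_def using that by (intro nat_mono floor_mono mult_right_mono) auto
  \<comment> \<open>The index at the next level is twice the old one or one more: the point stays,
    or moves to the adjacent inserted point.\<close>
  have f_step: "dist (f n t) (f (Suc n) t) \<le> q ^ n * s" if "0 \<le> t" for n t
  proof -
    have "\<lfloor>t * 2 ^ n\<rfloor> = \<lfloor>t * 2 ^ Suc n\<rfloor> div 2"
      using floor_divide_real_eq_div[of 2 "t * 2 ^ Suc n"] by simp
    then have "K n t = K (Suc n) t div 2"
      unfolding K_def by (simp add: nat_div_distrib)
    then consider "K (Suc n) t = 2 * K n t" | "K (Suc n) t = Suc (2 * K n t)"
      by (metis even_two_times_div_two odd_two_times_div_two_succ Suc_eq_plus1)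
    then show ?thesis
    proof cases
      case 1
      then show ?thesis using P_even s0 q by (simp add: f_def)
    next
      case 2
      have "dist (f n t) (f (Suc n) t) \<le> q ^ Suc n * s"
        using Pq[of "Suc n" "2 * K n t"] 2 P_even by (simp add: f_def)
      also have "\<dots> \<le> q ^ n * s"
        using q s0 by (intro mult_right_mono power_decreasing) auto
      finally show ?thesis .
    qed
  qed
  \<comment> \<open>Sum of the geometric series of the bounds in \<open>f_step\<close>.\<close>
  define C where "C = s / (1 - q)"
  have f_tail: "dist (f n t) (f (n + j) t) \<le> q ^ n * C" if "0 \<le> t" for n j t
  proof -
    have "dist (f n t) (f (n + j) t) \<le> (\<Sum>i<j. q ^ (n + i) * s)"
    proof (induction j)
      case (Suc j)
      then show ?case
        using dist_triangle[of "f n t" "f (n + Suc j) t" "f (n + j) t"] f_step[OF that, of "n + j"]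
        by simp
    qed simp
    also have "\<dots> = q ^ n * s * (\<Sum>i<j. q ^ i)"
      by (simp add: sum_distrib_left power_add mult_ac)
    also have "\<dots> \<le> q ^ n * s * (1 / (1 - q))"
    proof (rule mult_left_mono)
      show "(\<Sum>i<j. q ^ i) \<le> 1 / (1 - q)"
        using q sum_le_suminf[of "\<lambda>i. q ^ i" "{..<j}"] summable_geometric[of q]
        by (simp add: suminf_geometric)
    qed (use q s0 in simp)
    finally show ?thesis by (simp add: C_def)
  qed
  have q_lim: "(\<lambda>n. q ^ n * r) \<longlonglongrightarrow> 0" for r
    using q by (intro tendsto_mult_left_zero LIMSEQ_power_zero) auto
  have "\<exists>l. (\<lambda>n. f n t) \<longlonglongrightarrow> l" if "0 \<le> t" for t
  proof -
    have "Cauchy (\<lambda>n. f n t)"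
      unfolding Cauchy_altdef2
    proof (intro allI impI)
      fix e :: real assume "e > 0"
      then obtain N where N: "q ^ N * C < e"
        using order_tendstoD(2)[OF q_lim[of C]] by (metis eventually_sequentially order_refl)
      have "dist (f n t) (f N t) < e" if "n \<ge> N" for n
        using f_tail[OF \<open>0 \<le> t\<close>, of N "n - N"] N that by (simp add: dist_commute)
      then show "\<exists>N. \<forall>n\<ge>N. dist (f n t) (f N t) < e" by blast
    qed
    then show ?thesis by (simp add: Cauchy_convergent_iff convergent_def)
  qed
  then obtain \<gamma> where \<gamma>: "\<And>t. 0 \<le> t \<Longrightarrow> (\<lambda>n. f n t) \<longlonglongrightarrow> \<gamma> t" by metis
  have \<gamma>_near: "dist (f n t) (\<gamma> t) \<le> q ^ n * C" if "0 \<le> t" for n t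
  proof -
    have "(\<lambda>j. f (j + n) t) \<longlonglongrightarrow> \<gamma> t" using \<gamma>[OF that] by (rule LIMSEQ_ignore_initial_segment)
    then have "(\<lambda>j. dist (f n t) (f (j + n) t)) \<longlonglongrightarrow> dist (f n t) (\<gamma> t)"
      by (intro tendsto_intros)
    then show ?thesis
      by (rule LIMSEQ_le_const2) (use f_tail[OF that, of n] in \<open>auto simp: add.commute\<close>)
  qed
  have f_close: "dist (f n t) (f n u) \<le> q ^ n * s" if "0 \<le> t" "t \<le> u" "u - t < 1 / 2 ^ n" for n t u
  proof -
    have "u * 2 ^ n < t * 2 ^ n + 1" using that by (simp add: field_simps)
    then have "\<lfloor>u * 2 ^ n\<rfloor> \<le> \<lfloor>t * 2 ^ n\<rfloor> + 1" by linarith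
    then have "K n u \<le> Suc (K n t)" unfolding K_def by linarith
    then consider "K n u = K n t" | "K n u = Suc (K n t)"
      using K_mono[OF \<open>t \<le> u\<close>, of n] by linarith
    then show ?thesis
      by cases (use Pq[of n "K n t"] q s0 in \<open>auto simp: f_def\<close>)
  qed
  have cont: "continuous_on {0..1} \<gamma>"
    unfolding continuous_on_iff
  proof (intro ballI allI impI)
    fix t e :: real assume t: "t \<in> {0..1}" and "e > 0"
    \<comment> \<open>Two approximation errors \<open>q ^ n * C\<close>, at \<open>t\<close> and at
      \<open>u\<close>, and one jump \<open>q ^ n * s\<close> between neighbouring steps.\<close>
    then obtain n where n: "q ^ n * (2 * C + s) < e"
      using order_tendstoD(2)[OF q_lim[of "2 * C + s"]] by (metis eventually_sequentially order_refl)
    have "dist (\<gamma> u) (\<gamma> t) < e" if u: "u \<in> {0..1}" "dist u t < 1 / 2 ^ n" for u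
    proof -
      have "dist (f n t) (f n u) \<le> q ^ n * s"
        using f_close[of t u n] f_close[of u t n] t u
        by (cases "t \<le> u") (auto simp: dist_real_def dist_commute)
      then have "dist (\<gamma> u) (\<gamma> t) \<le> q ^ n * C + (q ^ n * s + q ^ n * C)"
        using \<gamma>_near[of t n] \<gamma>_near[of u n] t u
          dist_triangle[of "\<gamma> u" "\<gamma> t" "f n u"] dist_triangle[of "f n u" "\<gamma> t" "f n t"]
          dist_commute[of "\<gamma> u" "f n u"] dist_commute[of "f n u" "f n t"]
        unfolding atLeastAtMost_iff by linarith
      then show ?thesis using n by (simp add: algebra_simps)
    qed
    then show "\<exists>d>0. \<forall>u\<in>{0..1}. dist u t < d \<longrightarrow> dist (\<gamma> u) (\<gamma> t) < e"
      by (intro exI[of _ "1 / 2 ^ n"]) auto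
  qed
  have "\<gamma> t \<in> A" if "0 \<le> t" for t
    using closed_sequentially[OF A(1) _ \<gamma>[OF that]] PA by (simp add: f_def)
  moreover have "\<gamma> 0 = a"
    using \<gamma>[of 0] by (simp add: f_def K_def P_def LIMSEQ_const_iff)
  moreover have K1: "K n 1 = 2 ^ n" for n
    unfolding K_def by (metis floor_numeral_power mult_1 nat_numeral nat_power_eq zero_le_numeral)
  moreover have "\<gamma> 1 = b"
    using \<gamma>[of 1] by (simp add: f_def K1 P_def LIMSEQ_const_iff)
  moreover have "total_variation 0 1 \<gamma> \<le> ereal (len a b)"
    unfolding total_variation_def
  proof (rule SUP_least, clarify)
    fix N p assume "(N, p) \<in> partitions 0 1"
    then have p: "p 0 = 0" "p N = 1" and p_less: "\<And>i. i < N \<Longrightarrow> p i < p (Suc i)"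
      by (auto simp: partitions_def)
    have p0: "0 \<le> p i" if "i \<le> N" for i
      using that
    proof (induction i)
      case (Suc i)
      then show ?case using p_less[of i] by linarith
    qed (simp add: p)
    \<comment> \<open>The points \<open>p i\<close> need not be dyadic. The bound holds at every
      level and passes to the limit because the partition is finite and fixed.\<close>
    have "(\<Sum>i<N. dist (f n (p i)) (f n (p (Suc i)))) \<le> len a b" for n
    proof -
      have "(\<Sum>i<N. dist (f n (p i)) (f n (p (Suc i)))) \<le>
          (\<Sum>i<N. B n (K n (p (Suc i))) - B n (K n (p i)))"
        unfolding f_def
        by (intro sum_mono B_diff K_mono less_imp_le p_less) auto
      also have "\<dots> = B n (K n (p N)) - B n (K n (p 0))"
        by (rule sum_lessThan_telescope)
      also have "\<dots> = B n (2 ^ n)" by (simp add: p K1) (simp add: K_def B_def)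
      finally show ?thesis using B_total[of n] by linarith
    qed
    moreover have "(\<lambda>n. \<Sum>i<N. dist (f n (p i)) (f n (p (Suc i)))) \<longlonglongrightarrow>
        (\<Sum>i<N. dist (\<gamma> (p i)) (\<gamma> (p (Suc i))))"
      by (intro tendsto_sum tendsto_dist \<gamma> p0) auto
    ultimately show "ereal (\<Sum>i<N. dist (\<gamma> (p i)) (\<gamma> (p (Suc i)))) \<le> ereal (len a b)"
      by (auto intro: LIMSEQ_le_const2)
  qed
  ultimately show ?thesis using cont by auto
qed

section \<open>Growth of the distance function\<close>

text \<open>Ekeland's principle for maximisation. The points of \<open>F u\<close> are those whose
  gain over \<open>u\<close> pays for the distance at rate \<open>\<sigma>\<close>. Along a sequence
  of almost optimal choices these sets are nested and shrink to one point \<open>z\<close>.\<close>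

lemma ekeland:
  fixes f :: "'a::complete_space \<Rightarrow> real"
  assumes S: "closed S" "x \<in> S" and f: "continuous_on S f" "bdd_above (f ` S)" and "\<sigma> > 0"
  shows "\<exists>z\<in>S. f x + \<sigma> * dist x z \<le> f z \<and> (\<forall>v\<in>S. v \<noteq> z \<longrightarrow> f v < f z + \<sigma> * dist z v)"
proof -
  define F where "F u = {v \<in> S. f u + \<sigma> * dist u v \<le> f v}" for u
  have F_sub: "F v \<subseteq> F u" if "v \<in> F u" for u v
  proof
    fix w assume "w \<in> F v"
    moreover have "\<sigma> * dist u w \<le> \<sigma> * (dist u v + dist v w)"
      using \<open>\<sigma> > 0\<close> by (intro mult_left_mono dist_triangle) auto
    ultimately show "w \<in> F u"
      using that by (auto simp: F_def algebra_simps)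
  qed
  have F_refl: "u \<in> F u" if "u \<in> S" for u using that by (simp add: F_def)
  have bdd: "bdd_above (f ` F u)" for u
    using f(2) by (rule bdd_above_mono) (auto simp: F_def)
  have "\<exists>v. v \<in> F u \<and> (\<forall>w\<in>F u. f w \<le> f v + e)" if "u \<in> S" "e > 0" for u e
  proof -
    have "\<exists>y\<in>f ` F u. Sup (f ` F u) - e < y"
      using less_cSupD[of "f ` F u" "Sup (f ` F u) - e"] F_refl[OF that(1)] that(2) by auto
    then obtain v where v: "v \<in> F u" "Sup (f ` F u) - e < f v" by auto
    moreover have "f w \<le> f v + e" if "w \<in> F u" for w
    proof -
      have "f w \<le> Sup (f ` F u)" using that bdd by (intro cSup_upper) auto
      then show ?thesis using v by linarith
    qed
    ultimately show ?thesis by blast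
  qed
  then obtain g where g: "\<And>u e. u \<in> S \<Longrightarrow> e > 0 \<Longrightarrow> g u e \<in> F u \<and> (\<forall>w\<in>F u. f w \<le> f (g u e) + e)"
    by metis
  \<comment> \<open>With the factor \<open>\<sigma>\<close>, near optimality up to
    \<open>e n\<close> means that \<open>F (u (Suc n))\<close> has radius at most
    \<open>(1 / 2) ^ n\<close> about \<open>u (Suc n)\<close>.\<close>
  define e where "e n = \<sigma> * (1 / 2) ^ n" for n
  have e0: "e n > 0" for n using \<open>\<sigma> > 0\<close> by (simp add: e_def)
  define u where "u = rec_nat x (\<lambda>n u. g u (e n))"
  have u_Suc: "u (Suc n) = g (u n) (e n)" for n by (simp add: u_def)
  have uS: "u n \<in> S" for n
  proof (induction n)
    case 0
    then show ?case using S by (simp add: u_def)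
  next
    case (Suc n)
    then show ?case using g[OF Suc e0, of n] by (auto simp: u_Suc F_def)
  qed
  have u_F: "u (Suc n) \<in> F (u n)" for n
    using g[OF uS e0] by (simp add: u_Suc)
  have F_anti: "F (u n) \<subseteq> F (u m)" if "m \<le> n" for m n
    using that by (induction n rule: dec_induct) (use F_sub[OF u_F] in auto)
  have F_small: "dist (u (Suc n)) w \<le> (1 / 2) ^ n" if "w \<in> F (u (Suc n))" for n w
  proof -
    have "f w \<le> f (u (Suc n)) + e n"
      using g[OF uS e0, of n n] that F_sub[OF u_F] by (auto simp: u_Suc)
    moreover have "f (u (Suc n)) + \<sigma> * dist (u (Suc n)) w \<le> f w" using that by (simp add: F_def)
    ultimately have "\<sigma> * dist (u (Suc n)) w \<le> \<sigma> * (1 / 2) ^ n" by (simp add: e_def)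
    then show ?thesis using \<open>\<sigma> > 0\<close> by simp
  qed
  have half: "(\<lambda>n. (1 / 2 :: real) ^ n) \<longlonglongrightarrow> 0"
    by (rule LIMSEQ_power_zero) simp
  have "Cauchy u"
    unfolding Cauchy_altdef2
  proof (intro allI impI)
    fix r :: real assume "r > 0"
    then obtain N where N: "(1 / 2) ^ N < r"
      using order_tendstoD(2)[OF half] by (metis eventually_sequentially order_refl)
    have "dist (u n) (u (Suc N)) < r" if "n \<ge> Suc N" for n
      using F_small[of "u n" N] F_anti[OF that] F_refl[OF uS, of n] N
      by (auto simp: dist_commute)
    then show "\<exists>N. \<forall>n\<ge>N. dist (u n) (u N) < r" by blast
  qed
  then obtain z where z: "u \<longlonglongrightarrow> z"
    by (auto simp: Cauchy_convergent_iff convergent_def)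
  have zS: "z \<in> S" using closed_sequentially[OF S(1) _ z] uS by blast
  have "(\<lambda>n. f (u n)) \<longlonglongrightarrow> f z"
    using continuous_on_tendsto_compose[OF f(1) z zS] uS by simp
  have z_F: "z \<in> F (u n)" for n
  proof -
    have "(\<lambda>m. f (u n) + \<sigma> * dist (u n) (u m)) \<longlonglongrightarrow> f (u n) + \<sigma> * dist (u n) z"
      by (intro tendsto_intros z)
    then have "f (u n) + \<sigma> * dist (u n) z \<le> f z"
      using \<open>(\<lambda>n. f (u n)) \<longlonglongrightarrow> f z\<close>
    proof (rule LIMSEQ_le)
      show "\<exists>N. \<forall>m\<ge>N. f (u n) + \<sigma> * dist (u n) (u m) \<le> f (u m)"
        using F_anti F_refl[OF uS] unfolding F_def by blast
    qed
    then show ?thesis using zS by (simp add: F_def)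
  qed
  \<comment> \<open>A violating \<open>v\<close> would lie in \<open>F z\<close>, hence in every
    \<open>F (u n)\<close>, and so coincide with \<open>z\<close>.\<close>
  have "f v < f z + \<sigma> * dist z v" if "v \<in> S" "v \<noteq> z" for v
  proof (rule ccontr)
    assume "\<not> ?thesis"
    then have "v \<in> F z" using that by (simp add: F_def)
    then have "v \<in> F (u n)" for n using F_sub[OF z_F] by blast
    then have "dist (u (Suc n)) v \<le> (1 / 2) ^ n" for n using F_small by blast
    moreover have "(\<lambda>n. dist (u (Suc n)) v) \<longlonglongrightarrow> dist z v"
      by (intro tendsto_intros LIMSEQ_Suc z)
    ultimately have "dist z v \<le> 0"
      using half by (intro LIMSEQ_le) auto
    then show False using that by simp
  qed
  then show ?thesis using z_F[of 0] zS by (intro bexI[of _ z]) (auto simp: F_def u_def)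
qed

text \<open>A step towards an almost nearest point lowers the distance at rate almost 1. The
  derivative is linear, so the opposite step raises it at almost the same rate.\<close>

lemma infdist_slope:
  fixes A :: "'a::real_normed_vector set"
  assumes D: "((\<lambda>x. infdist x A) has_derivative D) (at x)"
    and d: "0 < infdist x A" and "\<sigma> < 1" "e > 0"
  shows "\<exists>z. z \<noteq> x \<and> dist x z < e \<and> infdist x A + \<sigma> * dist x z \<le> infdist z A"
proof -
  define d where "d = infdist x A"
  \<comment> \<open>Three errors of size \<open>\<eta> * t\<close> occur: the choice of
    \<open>y\<close> and the linearisation at the two opposite steps.\<close>
  define \<eta> where "\<eta> = (1 - \<sigma>) / 3"
  have "\<eta> > 0" using \<open>\<sigma> < 1\<close> by (simp add: \<eta>_def)
  have "linear D" using D by (rule has_derivative_linear)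
  obtain \<delta> where "\<delta> > 0" and
    \<delta>: "\<And>y. norm (y - x) < \<delta> \<Longrightarrow> norm (infdist y A - d - D (y - x)) \<le> \<eta> * norm (y - x)"
    using D \<open>\<eta> > 0\<close> unfolding has_derivative_at_alt d_def by blast
  \<comment> \<open>The bound \<open>t < d\<close> keeps the step towards \<open>y\<close> from
    overshooting \<open>y\<close>.\<close>
  define t where "t = min (min \<delta> e) d / 2"
  have t: "0 < t" "t < \<delta>" "t < e" "t < d"
    using \<open>\<delta> > 0\<close> \<open>e > 0\<close> d by (auto simp: t_def d_def)
  have "A \<noteq> {}" using d by (auto simp: infdist_def)
  moreover have "infdist x A < d + \<eta> * t" using \<open>\<eta> > 0\<close> t by (simp add: d_def)
  ultimately obtain y where y: "y \<in> A" "dist x y < d + \<eta> * t"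
    by (auto simp: infdist_def cInf_less_iff)
  have dy: "d \<le> norm (y - x)"
    using infdist_le[OF y(1), of x] by (simp add: d_def dist_norm norm_minus_commute)
  define u where "u = (1 / norm (y - x)) *\<^sub>R (y - x)"
  have u: "norm u = 1" "y - x = norm (y - x) *\<^sub>R u"
    using dy t by (auto simp: u_def)
  have "y - (x + t *\<^sub>R u) = (norm (y - x) - t) *\<^sub>R u"
    unfolding scaleR_left_diff_distrib u(2)[symmetric] by simp
  then have "dist (x + t *\<^sub>R u) y = norm ((norm (y - x) - t) *\<^sub>R u)"
    by (simp add: dist_norm norm_minus_commute)
  also have "\<dots> = norm (y - x) - t" using u dy t by simp
  finally have "infdist (x + t *\<^sub>R u) A \<le> d + \<eta> * t - t"
    using infdist_le[OF y(1), of "x + t *\<^sub>R u"] y(2) by (simp add: dist_norm norm_minus_commute)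
  moreover have "\<bar>infdist (x + t *\<^sub>R u) A - d - D (t *\<^sub>R u)\<bar> \<le> \<eta> * t"
    using \<delta>[of "x + t *\<^sub>R u"] u t by simp
  moreover have "\<bar>infdist (x - t *\<^sub>R u) A - d + D (t *\<^sub>R u)\<bar> \<le> \<eta> * t"
    using \<delta>[of "x - t *\<^sub>R u"] u t by (simp add: linear_neg[OF \<open>linear D\<close>])
  ultimately have "d + t - 3 * (\<eta> * t) \<le> infdist (x - t *\<^sub>R u) A" by linarith
  moreover have "d + t - 3 * (\<eta> * t) = d + \<sigma> * t" by (simp add: \<eta>_def field_simps)
  ultimately show ?thesis
    using t u by (intro exI[of _ "x - t *\<^sub>R u"]) (auto simp: dist_norm d_def)
qed

text \<open>At an Ekeland point of the closed ball no other point of the ball gains at rate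
  \<open>\<sigma>\<close>. In the interior \<open>infdist_slope\<close> supplies such a point, so
  the Ekeland point lies on the boundary sphere.\<close>

lemma infdist_growth:
  fixes A :: "'a::{real_normed_vector, complete_space} set"
  assumes D: "\<And>y. 0 < infdist y A \<Longrightarrow> infdist y A < R \<Longrightarrow>
      \<exists>D. ((\<lambda>x. infdist x A) has_derivative D) (at y)"
    and x: "0 < infdist x A" "0 \<le> \<rho>" "infdist x A + \<rho> < R" and \<sigma>: "0 < \<sigma>" "\<sigma> < 1"
  shows "\<exists>z. dist x z \<le> \<rho> \<and> infdist x A + \<sigma> * \<rho> \<le> infdist z A"
proof -
  have lip: "infdist z A \<le> infdist x A + dist x z" for z
    using infdist_triangle[of z A x] by (simp add: dist_commute)
  have "\<exists>z\<in>cball x \<rho>. infdist x A + \<sigma> * dist x z \<le> infdist z A \<and>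
      (\<forall>v\<in>cball x \<rho>. v \<noteq> z \<longrightarrow> infdist v A < infdist z A + \<sigma> * dist z v)"
  proof (rule ekeland[where f = "\<lambda>z. infdist z A"])
    show "bdd_above ((\<lambda>z. infdist z A) ` cball x \<rho>)"
    proof (rule bdd_aboveI2)
      fix z assume "z \<in> cball x \<rho>"
      then show "infdist z A \<le> infdist x A + \<rho>" using lip[of z] by simp
    qed
    show "continuous_on (cball x \<rho>) (\<lambda>z. infdist z A)" by (intro continuous_intros)
  qed (use x \<sigma> in auto)
  then obtain z where z: "dist x z \<le> \<rho>" "infdist x A + \<sigma> * dist x z \<le> infdist z A"
    and z_max: "\<And>v. dist x v \<le> \<rho> \<Longrightarrow> v \<noteq> z \<Longrightarrow> infdist v A < infdist z A + \<sigma> * dist z v"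
    by auto
  have "dist x z = \<rho>"
  proof (rule ccontr)
    assume "dist x z \<noteq> \<rho>"
    then have less: "dist x z < \<rho>" using z by simp
    have "0 \<le> \<sigma> * dist x z" using \<sigma> by simp
    \<comment> \<open>The distance has not dropped from \<open>x\<close> to \<open>z\<close>, and
      being 1-Lipschitz it stays below \<open>R\<close>; hence it is differentiable at
      \<open>z\<close>.\<close>
    then have "0 < infdist z A" "infdist z A < R" using z x lip[of z] by linarith+
    then obtain D where "((\<lambda>x. infdist x A) has_derivative D) (at z)" using D by blast
    from infdist_slope[OF this \<open>0 < infdist z A\<close> \<sigma>(2), of "\<rho> - dist x z"] less
    obtain v where v: "v \<noteq> z" "dist z v < \<rho> - dist x z" "infdist z A + \<sigma> * dist z v \<le> infdist v A"
      by auto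
    moreover have "dist x v \<le> \<rho>" using dist_triangle[of x v z] v by linarith
    ultimately show False using z_max by fastforce
  qed
  then show ?thesis using z by auto
qed

section \<open>Midpoints\<close>

lemma infdist_midpoint:
  fixes A :: "'a::{real_inner, complete_space} set"
  assumes D: "\<And>y. 0 < infdist y A \<Longrightarrow> infdist y A < R \<Longrightarrow>
      \<exists>D. ((\<lambda>x. infdist x A) has_derivative D) (at y)"
    and ab: "a \<in> A" "b \<in> A" "dist a b < 2 * R"
  shows "infdist (midpoint a b) A \<le> R - sqrt (R\<^sup>2 - (dist a b / 2)\<^sup>2)"
proof -
  define m where "m = midpoint a b"
  define d where "d = infdist m A"
  define s where "s = dist a b / 2"
  have s: "0 \<le> s" "s < R" using ab by (auto simp: s_def)
  have "d \<le> s"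
    using infdist_le[OF ab(1), of m] by (simp add: d_def m_def s_def dist_midpoint)
  have "0 \<le> d" by (simp add: d_def infdist_nonneg)
  \<comment> \<open>The claim in squared form. For \<open>d = 0\<close> it is trivial; growth can
    only start from a point off \<open>A\<close>.\<close>
  have "R\<^sup>2 \<le> (R - d)\<^sup>2 + s\<^sup>2"
  proof (cases "d = 0")
    case False
    \<comment> \<open>Growth needs a slope below 1 and a radius below \<open>R - d\<close>. One
      parameter \<open>\<tau>\<close> controls both and then tends to 1.\<close>
    have "(d + \<tau> * (\<tau> * (R - d)))\<^sup>2 \<le> (\<tau> * (R - d))\<^sup>2 + s\<^sup>2" if \<tau>: "0 < \<tau>" "\<tau> < 1" for \<tau>
    proof -
      have "\<tau> * (R - d) < R - d" using \<tau> s \<open>d \<le> s\<close> by simp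
      then obtain z where z: "dist m z \<le> \<tau> * (R - d)" "d + \<tau> * (\<tau> * (R - d)) \<le> infdist z A"
        using infdist_growth[where R = R, OF D, where x = m and \<rho> = "\<tau> * (R - d)" and \<sigma> = \<tau>] \<tau> s \<open>d \<le> s\<close> \<open>0 \<le> d\<close> False
        by (auto simp: d_def)
      have "0 \<le> d + \<tau> * (\<tau> * (R - d))" using \<tau> s \<open>d \<le> s\<close> \<open>0 \<le> d\<close> by simp
      then have "(d + \<tau> * (\<tau> * (R - d)))\<^sup>2 \<le> (dist z y)\<^sup>2" if "y \<in> A" for y
        using z(2) infdist_le[OF that, of z] by (intro power_mono) linarith+
      from this[OF ab(1)] this[OF ab(2)]
      have "2 * (d + \<tau> * (\<tau> * (R - d)))\<^sup>2 \<le> (dist z a)\<^sup>2 + (dist z b)\<^sup>2" by linarith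
      \<comment> \<open>Parallelogram law for \<open>z - a\<close> and \<open>z - b\<close>.\<close>
      also have "\<dots> = 2 * (dist m z)\<^sup>2 + 2 * s\<^sup>2"
        unfolding dist_norm m_def s_def midpoint_def power2_norm_eq_inner power_divide
        by (simp add: inner_simps inner_commute field_simps)
      also have "(dist m z)\<^sup>2 \<le> (\<tau> * (R - d))\<^sup>2" using z(1) by (intro power_mono) auto
      finally show ?thesis by simp
    qed
    then have "\<forall>\<^sub>F \<tau> in at_left (1::real). (d + \<tau> * (\<tau> * (R - d)))\<^sup>2 \<le> (\<tau> * (R - d))\<^sup>2 + s\<^sup>2"
      using eventually_at_left_real[of 0 "1::real"] by (auto elim: eventually_mono)
    then have "(d + 1 * (1 * (R - d)))\<^sup>2 \<le> (1 * (R - d))\<^sup>2 + s\<^sup>2"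
      by (rule tendsto_le[rotated 3]) (simp, (intro tendsto_intros)+)
    then show ?thesis by simp
  qed (use s in simp)
  then have "sqrt (R\<^sup>2 - s\<^sup>2) \<le> R - d"
    using s \<open>d \<le> s\<close> by (intro real_le_lsqrt) auto
  then show ?thesis by (simp add: d_def s_def m_def)
qed

text \<open>A point \<open>z\<close> near which \<open>d\<close> almost attains its maximal growth \<open>d x + \<rho>\<close> forces all almost
  nearest points of \<open>x\<close> to lie near the point \<open>w\<close> opposite to \<open>z\<close>.\<close>

lemma nearest_point_in_tube:
  fixes A :: "'a::{real_inner, complete_space} set"
  assumes D: "\<And>y. 0 < infdist y A \<Longrightarrow> infdist y A < R \<Longrightarrow>
      \<exists>D. ((\<lambda>x. infdist x A) has_derivative D) (at y)"
    and A: "closed A" and x: "0 < infdist x A" "infdist x A < R"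
  shows "\<exists>c\<in>A. dist x c = infdist x A"
proof -
  define d where "d = infdist x A"
  define \<rho> where "\<rho> = (R - d) / 2"
  have pos: "0 < d" "0 < \<rho>" "d + \<rho> < R" using x by (auto simp: d_def \<rho>_def field_simps)
  have near: "\<exists>w \<delta>. 0 < \<delta> \<and> (\<forall>y\<in>A. dist x y \<le> d + \<delta> \<longrightarrow> dist y w < \<eta>)" if "\<eta> > 0" for \<eta>
  proof -
    \<comment> \<open>Upper bound for the squared distance from \<open>w\<close> of any point of
      \<open>A\<close> within \<open>d + (1 - \<tau>)\<close> of \<open>x\<close>. It vanishes at 1,
      so some \<open>\<tau>\<close> below 1 makes it smaller than \<open>\<eta>\<close>
      squared.\<close>
    define g where "g \<tau> = (d + (1 - \<tau>))\<^sup>2 + d\<^sup>2 - d / \<rho> * ((d + \<tau> * \<rho>)\<^sup>2 - (d + (1 - \<tau>))\<^sup>2 - \<rho>\<^sup>2)"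
      for \<tau> :: real
    have "(g \<longlongrightarrow> g 1) (at_left 1)"
      unfolding g_def by (intro tendsto_intros)
    moreover have "g 1 = 0" using pos by (simp add: g_def field_simps power2_eq_square)
    ultimately have "\<forall>\<^sub>F \<tau> in at_left 1. g \<tau> < \<eta>\<^sup>2"
      using \<open>\<eta> > 0\<close> by (intro order_tendstoD(2)) auto
    then have "\<forall>\<^sub>F \<tau> in at_left 1. g \<tau> < \<eta>\<^sup>2 \<and> \<tau> \<in> {0<..<1}"
      using eventually_at_left_real[of 0 "1::real"] by (intro eventually_conj) auto
    then obtain \<tau> where \<tau>: "g \<tau> < \<eta>\<^sup>2" "0 < \<tau>" "\<tau> < 1"
      using eventually_happens[of _ "at_left (1::real)"] by auto
    obtain z where z: "dist x z \<le> \<rho>" "d + \<tau> * \<rho> \<le> infdist z A"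
      using infdist_growth[where R = R, OF D, where x = x and \<rho> = \<rho> and \<sigma> = \<tau>] pos \<tau> by (auto simp: d_def)
    define w where "w = x + (d / \<rho>) *\<^sub>R (x - z)"
    have "dist y w < \<eta>" if y: "y \<in> A" "dist x y \<le> d + (1 - \<tau>)" for y
    proof -
      define i where "i = (y - x) \<bullet> (x - z)"
      have xy: "(norm (y - x))\<^sup>2 \<le> (d + (1 - \<tau>))\<^sup>2"
        using y by (intro power_mono) (auto simp: dist_norm norm_minus_commute)
      have xz: "(norm (x - z))\<^sup>2 \<le> \<rho>\<^sup>2"
        using z by (intro power_mono) (auto simp: dist_norm)
      have "0 \<le> d + \<tau> * \<rho>" using pos \<tau> by simp
      \<comment> \<open>Since \<open>y\<close> is almost \<open>d + \<rho>\<close> away from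
        \<open>z\<close>, the triangle inequality through \<open>x\<close> is nearly sharp. This
        bounds \<open>i\<close> from below, so \<open>y - x\<close> points almost along
        \<open>x - z\<close>.\<close>
      then have "(d + \<tau> * \<rho>)\<^sup>2 \<le> (norm ((y - x) + (x - z)))\<^sup>2"
        using z(2) infdist_le[OF y(1), of z]
        by (intro power_mono) (auto simp: dist_norm norm_minus_commute)
      also have "\<dots> = (norm (y - x))\<^sup>2 + 2 * i + (norm (x - z))\<^sup>2"
        unfolding i_def power2_norm_eq_inner by (simp only: inner_add) (simp add: inner_commute)
      finally have i: "(d + \<tau> * \<rho>)\<^sup>2 - (d + (1 - \<tau>))\<^sup>2 - \<rho>\<^sup>2 \<le> 2 * i"
        using xy xz by linarith
      have "y - w = (y - x) - (d / \<rho>) *\<^sub>R (x - z)" by (simp add: w_def)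
      moreover have "(norm (v - k *\<^sub>R v'))\<^sup>2 = (norm v)\<^sup>2 - k * (2 * (v \<bullet> v')) + k\<^sup>2 * (norm v')\<^sup>2"
        for v v' :: 'a and k
        unfolding power2_norm_eq_inner
        by (simp add: inner_diff inner_commute power2_eq_square algebra_simps)
      ultimately have "(dist y w)\<^sup>2 =
          (norm (y - x))\<^sup>2 - d / \<rho> * (2 * i) + (d / \<rho>)\<^sup>2 * (norm (x - z))\<^sup>2"
        unfolding i_def dist_norm by metis
      moreover have "d / \<rho> * ((d + \<tau> * \<rho>)\<^sup>2 - (d + (1 - \<tau>))\<^sup>2 - \<rho>\<^sup>2) \<le> d / \<rho> * (2 * i)"
        using i pos by (intro mult_left_mono) auto
      moreover have "(d / \<rho>)\<^sup>2 * (norm (x - z))\<^sup>2 \<le> (d / \<rho>)\<^sup>2 * \<rho>\<^sup>2"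
        using xz by (intro mult_left_mono) auto
      moreover have "(d / \<rho>)\<^sup>2 * \<rho>\<^sup>2 = d\<^sup>2" using pos by (simp add: power_divide)
      ultimately have "(dist y w)\<^sup>2 \<le> g \<tau>" using xy unfolding g_def by linarith
      then have "(dist y w)\<^sup>2 < \<eta>\<^sup>2" using \<tau> by linarith
      then show ?thesis by (rule power2_less_imp_less) (use \<open>\<eta> > 0\<close> in simp)
    qed
    then show ?thesis using \<tau> by (intro exI[of _ w] exI[of _ "1 - \<tau>"]) auto
  qed
  have "A \<noteq> {}" using x by (auto simp: infdist_def)
  \<comment> \<open>A minimising sequence is Cauchy by \<open>near\<close>, and its limit is the
    nearest point.\<close>
  then have "\<exists>y\<in>A. dist x y < d + inverse (Suc n)" for n
    using cInf_lessD[of "dist x ` A" "d + inverse (Suc n)"] by (auto simp: d_def infdist_def)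
  then obtain y where y: "\<And>n. y n \<in> A" "\<And>n. dist x (y n) < d + inverse (Suc n)" by metis
  have "Cauchy y"
  proof (rule metric_CauchyI)
    fix e :: real assume "e > 0"
    then obtain w \<delta> where "0 < \<delta>" and w: "\<And>y. y \<in> A \<Longrightarrow> dist x y \<le> d + \<delta> \<Longrightarrow> dist y w < e / 2"
      using near[of "e / 2"] by auto
    obtain N where N: "inverse (Suc N) < \<delta>" using reals_Archimedean[OF \<open>0 < \<delta>\<close>] by auto
    have "dist (y n) w < e / 2" if "n \<ge> N" for n
    proof (rule w)
      have "inverse (real (Suc n)) \<le> inverse (Suc N)" using that by (intro le_imp_inverse_le) auto
      then show "dist x (y n) \<le> d + \<delta>" using y(2)[of n] N by linarith
    qed (rule y)
    then show "\<exists>N. \<forall>m\<ge>N. \<forall>n\<ge>N. dist (y m) (y n) < e"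
      by (meson dist_triangle_half_l)
  qed
  then obtain c where c: "y \<longlonglongrightarrow> c"
    by (auto simp: Cauchy_convergent_iff convergent_def)
  have "c \<in> A" using closed_sequentially[OF A _ c] y by blast
  have "dist x c \<le> d + 0"
  proof (rule LIMSEQ_le)
    show "(\<lambda>n. dist x (y n)) \<longlonglongrightarrow> dist x c" by (intro tendsto_intros c)
    show "(\<lambda>n. d + inverse (real (Suc n))) \<longlonglongrightarrow> d + 0"
      by (intro tendsto_intros LIMSEQ_inverse_real_of_nat)
  qed (use y in \<open>auto intro: less_imp_le\<close>)
  then show ?thesis using infdist_le[OF \<open>c \<in> A\<close>, of x] \<open>c \<in> A\<close> by (auto simp: d_def)
qed

section \<open>Chords and arcs of a circle of radius \<open>R\<close>\<close>

text \<open>The identity \<open>cos (\<alpha> + \<beta>) * cos (\<alpha> - \<beta>) = 1 - (x^2 +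
  y^2)\<close> turns the hypothesis into a lower bound \<open>cos \<theta>\<close> for the product,
  and the second factor is at most 1.\<close>

lemma arcsin_add_le:
  fixes x y s :: real
  assumes x: "0 \<le> x" and y: "0 \<le> y" and s: "0 \<le> s" "s < 1" and le: "x\<^sup>2 + y\<^sup>2 \<le> 1 - sqrt (1 - s\<^sup>2)"
  shows "arcsin x + arcsin y \<le> arcsin s"
proof -
  have s2: "s\<^sup>2 < 1" using s by (simp add: power_less_one_iff)
  have "x\<^sup>2 + y\<^sup>2 \<le> 1" using le s2 by (smt (verit) real_sqrt_ge_zero)
  then have "x\<^sup>2 \<le> 1\<^sup>2" "y\<^sup>2 \<le> 1\<^sup>2" by (auto intro: order_trans[rotated])
  then have 1: "x \<le> 1" "y \<le> 1" by (auto intro: power2_le_imp_le)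
  define \<alpha> \<beta> \<theta> where "\<alpha> = arcsin x" and "\<beta> = arcsin y" and "\<theta> = arcsin s"
  have range: "0 \<le> \<alpha>" "\<alpha> \<le> pi / 2" "0 \<le> \<beta>" "\<beta> \<le> pi / 2" "0 \<le> \<theta>" "\<theta> \<le> pi / 2"
    unfolding \<alpha>_def \<beta>_def \<theta>_def
    using x y s 1 arcsin_ubound[of x] arcsin_ubound[of y] arcsin_ubound[of s]
    by (auto intro: arcsin_le_arcsin[of 0, simplified])
  have cos_\<theta>: "cos \<theta> = sqrt (1 - s\<^sup>2)" unfolding \<theta>_def using s by (intro cos_arcsin) auto
  then have "0 < cos \<theta>" using s2 by simp
  have "cos (\<alpha> + \<beta>) * cos (\<alpha> - \<beta>) = (cos \<alpha>)\<^sup>2 * (cos \<beta>)\<^sup>2 - (sin \<alpha>)\<^sup>2 * (sin \<beta>)\<^sup>2"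
    by (simp add: cos_add cos_diff power2_eq_square algebra_simps)
  also have "\<dots> = 1 - (x\<^sup>2 + y\<^sup>2)"
    using x y 1 by (simp add: cos_squared_eq \<alpha>_def \<beta>_def algebra_simps)
  finally have prod: "cos \<theta> \<le> cos (\<alpha> + \<beta>) * cos (\<alpha> - \<beta>)" using le cos_\<theta> by simp
  have "0 \<le> cos (\<alpha> - \<beta>)" using range by (intro cos_ge_zero) auto
  then have "0 \<le> cos (\<alpha> + \<beta>)"
    using prod \<open>0 < cos \<theta>\<close> by (smt (verit) mult_nonpos_nonneg)
  then have "cos (\<alpha> + \<beta>) * cos (\<alpha> - \<beta>) \<le> cos (\<alpha> + \<beta>)"
    by (simp add: mult_left_le)
  then have "cos \<theta> \<le> cos (\<alpha> + \<beta>)" using prod by linarith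
  then have "\<alpha> + \<beta> \<le> \<theta>" using range by (subst (asm) cos_mono_le_eq) auto
  then show ?thesis by (simp add: \<alpha>_def \<beta>_def \<theta>_def)
qed

text \<open>A crude bound on the height of the arc over a half chord \<open>s\<close>; it yields the
  contraction factor \<open>q\<close> of \<open>arc_bisection\<close>.\<close>

lemma circle_height_le:
  fixes R s :: real
  assumes "0 \<le> s" "s \<le> R" "0 < R"
  shows "R - sqrt (R\<^sup>2 - s\<^sup>2) \<le> s\<^sup>2 / R"
proof -
  have "s\<^sup>2 \<le> R\<^sup>2" using assms by (intro power_mono) auto
  moreover have "(s\<^sup>2)\<^sup>2 \<le> s\<^sup>2 * R\<^sup>2"
    unfolding power2_eq_square[of "s\<^sup>2"] using \<open>s\<^sup>2 \<le> R\<^sup>2\<close> by (intro mult_left_mono) auto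
  moreover have "(R - s\<^sup>2 / R)\<^sup>2 = R\<^sup>2 - 2 * s\<^sup>2 + (s\<^sup>2)\<^sup>2 / R\<^sup>2"
    using assms by (simp add: power2_diff power_divide)
  moreover have "(s\<^sup>2)\<^sup>2 / R\<^sup>2 \<le> s\<^sup>2"
    using assms \<open>(s\<^sup>2)\<^sup>2 \<le> s\<^sup>2 * R\<^sup>2\<close> by (simp add: pos_divide_le_eq)
  ultimately have "(R - s\<^sup>2 / R)\<^sup>2 \<le> R\<^sup>2 - s\<^sup>2" by linarith
  then have "R - s\<^sup>2 / R \<le> sqrt (R\<^sup>2 - s\<^sup>2)" by (rule real_le_rsqrt)
  then show ?thesis by linarith
qed

text \<open>The point \<open>c\<close> is nearest to the midpoint \<open>m\<close>, at distance at
  most the arc height \<open>h\<close>. The parallelogram law then bounds the sum of the squared new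
  chords by its value for the midpoint of the arc.\<close>

lemma arc_bisection:
  fixes A :: "'a::{real_inner, complete_space} set"
  assumes D: "\<And>y. 0 < infdist y A \<Longrightarrow> infdist y A < R \<Longrightarrow>
      \<exists>D. ((\<lambda>x. infdist x A) has_derivative D) (at y)"
    and A: "closed A" "a \<in> A" "b \<in> A" and ab: "dist a b < 2 * R"
  defines "q \<equiv> (1 + dist a b / (2 * R)) / 2"
  shows "\<exists>c\<in>A. dist a c \<le> q * dist a b \<and> dist c b \<le> q * dist a b \<and>
    2 * R * arcsin (dist a c / (2 * R)) + 2 * R * arcsin (dist c b / (2 * R)) \<le>
    2 * R * arcsin (dist a b / (2 * R))"
proof -
  define m where "m = midpoint a b"
  define s where "s = dist a b / 2"
  define h where "h = R - sqrt (R\<^sup>2 - s\<^sup>2)"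
  have s: "0 \<le> s" "s < R" and R: "0 < R"
    using ab by (auto simp: s_def) (smt (verit) zero_le_dist)
  have "infdist m A \<le> h"
    using infdist_midpoint[where R = R, OF D A(2,3) ab] by (simp add: m_def h_def s_def)
  have "infdist m A \<le> s"
    using infdist_le[OF A(2), of m] by (simp add: m_def s_def dist_midpoint)
  have "\<exists>c\<in>A. dist m c = infdist m A"
  proof (cases "infdist m A = 0")
    case True
    then have "m \<in> A" using A in_closed_iff_infdist_zero by blast
    then show ?thesis using True by force
  next
    case False
    then show ?thesis
      using nearest_point_in_tube[where R = R, OF D A(1)] infdist_nonneg[of m A] \<open>infdist m A \<le> s\<close> s
      by force
  qed
  then obtain c where c: "c \<in> A" "dist m c \<le> h" using \<open>infdist m A \<le> h\<close> by auto
  have "h \<le> s\<^sup>2 / R" unfolding h_def using s R by (intro circle_height_le) auto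
  \<comment> \<open>\<open>q\<close> is chosen so that
    \<open>q * dist a b = s + s^2 / R\<close>.\<close>
  then have "s + h \<le> q * dist a b"
    using R by (simp add: q_def s_def field_simps power2_eq_square)
  moreover have "dist a c \<le> s + h" "dist c b \<le> s + h"
    using c(2) dist_triangle[of a c m] dist_triangle[of c b m]
    by (auto simp: m_def s_def dist_midpoint dist_commute)
  moreover have "arcsin (dist a c / (2 * R)) + arcsin (dist c b / (2 * R)) \<le> arcsin (s / R)"
  proof (rule arcsin_add_le)
    have "(dist a c)\<^sup>2 + (dist c b)\<^sup>2 = 2 * (dist m c)\<^sup>2 + 2 * s\<^sup>2"
      unfolding dist_norm m_def s_def midpoint_def power2_norm_eq_inner power_divide
      by (simp add: inner_simps inner_commute field_simps)
    also have "(dist m c)\<^sup>2 \<le> h\<^sup>2" using c by (intro power_mono) auto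
    also have "s\<^sup>2 \<le> R\<^sup>2" using s by (intro power_mono) auto
    then have "2 * h\<^sup>2 + 2 * s\<^sup>2 = 4 * R\<^sup>2 - 4 * R * sqrt (R\<^sup>2 - s\<^sup>2)"
      by (simp add: h_def power2_diff)
    finally have "(dist a c)\<^sup>2 + (dist c b)\<^sup>2 \<le> 4 * R\<^sup>2 - 4 * R * sqrt (R\<^sup>2 - s\<^sup>2)" by simp
    then have "((dist a c)\<^sup>2 + (dist c b)\<^sup>2) / (4 * R\<^sup>2) \<le>
        (4 * R\<^sup>2 - 4 * R * sqrt (R\<^sup>2 - s\<^sup>2)) / (4 * R\<^sup>2)"
      by (intro divide_right_mono) auto
    also have "\<dots> = 1 - sqrt (R\<^sup>2 - s\<^sup>2) / R"
      using R by (simp add: field_simps power2_eq_square)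
    also have "sqrt (R\<^sup>2 - s\<^sup>2) / R = sqrt ((R\<^sup>2 - s\<^sup>2) / R\<^sup>2)"
      using R by (simp add: real_sqrt_divide)
    also have "(R\<^sup>2 - s\<^sup>2) / R\<^sup>2 = 1 - (s / R)\<^sup>2"
      using R by (simp add: diff_divide_distrib power_divide)
    finally show "(dist a c / (2 * R))\<^sup>2 + (dist c b / (2 * R))\<^sup>2 \<le> 1 - sqrt (1 - (s / R)\<^sup>2)"
      by (simp add: power_divide power_mult_distrib add_divide_distrib)
  qed (use s R in auto)
  then have "2 * R * (arcsin (dist a c / (2 * R)) + arcsin (dist c b / (2 * R))) \<le>
      2 * R * arcsin (dist a b / (2 * R))"
    using R by (simp add: s_def)
  ultimately show ?thesis using c(1) by (force simp: distrib_left)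
qed

theorem lemma1p2:
  fixes R :: real and A :: "'a::{real_inner, complete_space} set" and a b :: 'a
  assumes "\<exists>B::'a set. independent B \<and> card B = 2"
    and "R > 0"
    and "proximally_smooth R A"
    and "a \<in> A" and "b \<in> A" and "a \<noteq> b"
    and "norm (a - b) < 2 * R"
  shows "\<exists>(s::real) (t::real) (\<gamma>::real \<Rightarrow> 'a).
    s < t \<and> continuous_on {s..t} \<gamma> \<and> \<gamma> ` {s..t} \<subseteq> A \<and> \<gamma> s = a \<and> \<gamma> t = b \<and>
    total_variation s t \<gamma> \<le> ereal (2 * R * arcsin (norm (a - b) / (2 * R)))"
proof -
  note R = \<open>R > 0\<close>
  have A: "closed A"
    and D: "\<And>y. 0 < infdist y A \<Longrightarrow> infdist y A < R \<Longrightarrow>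
      \<exists>D. ((\<lambda>x. infdist x A) has_derivative D) (at y)"
    using assms(3) unfolding proximally_smooth_def continuously_differentiable_on_def by auto
  have ab: "dist a b < 2 * R" using assms(7) by (simp add: dist_norm)
  define q where "q = (1 + dist a b / (2 * R)) / 2"
  have q: "0 \<le> q" "q < 1" using R ab by (auto simp: q_def)
  have "\<exists>\<gamma>. continuous_on {0..1} \<gamma> \<and> \<gamma> ` {0..1} \<subseteq> A \<and> \<gamma> 0 = a \<and> \<gamma> 1 = b \<and>
    total_variation 0 1 \<gamma> \<le> ereal (2 * R * arcsin (dist a b / (2 * R)))"
  \<comment> \<open>Here \<open>len x y\<close> is the length of the shorter arc of radius
    \<open>R\<close> over a chord of length \<open>dist x y\<close>.\<close>
  proof (rule curve_from_midpoints[OF A assms(4,5) q])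
    fix x y assume xy: "x \<in> A" "y \<in> A" "dist x y \<le> dist a b"
    have le1: "dist x y / (2 * R) \<le> 1" using xy ab R by simp
    have "0 \<le> dist x y / (2 * R)" using R by simp
    then have "dist x y / (2 * R) \<le> arcsin (dist x y / (2 * R))"
      using sin_x_le_x[of "arcsin (dist x y / (2 * R))"] le1
        arcsin_le_arcsin[of 0 "dist x y / (2 * R)"] by simp
    then show "dist x y \<le> 2 * R * arcsin (dist x y / (2 * R))"
      using R by (simp add: field_simps)
    define r where "r = (1 + dist x y / (2 * R)) / 2"
    \<comment> \<open>The factor for a pair grows with its distance, so the one for
      \<open>a\<close>, \<open>b\<close> serves for all closer pairs.\<close>
    have "r * dist x y \<le> q * dist x y"
      unfolding r_def q_def using xy R by (intro mult_right_mono) (auto simp: divide_right_mono)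
    moreover have "dist x y < 2 * R" using xy ab by linarith
    ultimately show "\<exists>c\<in>A. dist x c \<le> q * dist x y \<and> dist c y \<le> q * dist x y \<and>
        2 * R * arcsin (dist x c / (2 * R)) + 2 * R * arcsin (dist c y / (2 * R)) \<le>
        2 * R * arcsin (dist x y / (2 * R))"
      using arc_bisection[where R = R, OF D A xy(1,2)] unfolding r_def by (meson order_trans)
  qed
  then show ?thesis unfolding dist_norm by (metis zero_less_one)
qed

end
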